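(* Let $\varepsilon>0$, $\underline{\sigma}>0$ and let $a<b$ be real. Let $n\ge O(\log(n(b-a)/\underline{\sigma})/\varepsilon)$ be an integer. Then there exists a $\frac12\varepsilon^2$-CDP algorithm $M:\mathbb{R}^n\to\mathbb{R}$ such that the following holds. Let $\mathcal{D}$ be a distribution on $\mathbb{R}$ with mean $\mu\in[a,b]$ and variance $\sigma^2\ge\underline{\sigma}^2$. Then $$\mathbb{E}_{X\leftarrow\mathcal{D}^n}\left[(M(X)-\mu)^2\right]\le\frac{\sigma^2}{n}\cdot O\left(\frac{\log(n(b-a)/\underline{\sigma})}{\varepsilon}+\frac1{\varepsilon^2}\right),$$ where the expectation is over both the i.i.d. sample $X$ and the internal randomness of $M$.
   Context: $O(\cdot)$ hides universal constants; "$n\ge O(g)$" means that $n$ is at least a suitable universal constant times $g$. The algorithm $M$ does not depend on $\mathcal{D}$ (it may depend on $\varepsilon,\underline\sigma,a,b,n$). $X\leftarrow\mathcal{D}^n$ means $n$ i.i.d. samples from $\mathcal{D}$. A randomized algorithm $M:\mathbb{R}^n\to\mathbb{R}$ assigns to each $x\in\mathbb{R}^n$ a real random variable $M(x)$. For $\alpha\in(1,\infty)$, $D_\alpha(P\|Q)=\frac{1}{\alpha-1}\log\mathbb{E}_{X\leftarrow P}\left[(P(X)/Q(X))^{\alpha-1}\right]$ is the Rényi divergence of order $\alpha$ (ratio of densities, $+\infty$ if $P$ is not absolutely continuous with respect to $Q$). $M$ is $\frac12\varepsilon^2$-CDP (concentrated differentially private) if $D_\alpha(M(x)\|M(y))\le\frac12\varepsilon^2\alpha$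 for all $x,y\in\mathbb{R}^n$ differing in at most one entry and all $\alpha\in(1,\infty)$.
   Formalization: The factor O(log(n(b-a)/σ)/ε + 1/ε²), σ the lower bound on the standard deviation, is read as C·max{1, log(n(b-a)/σ)/ε + 1/ε²}, since without the floor 1 the bound fails for large ε and can be negative when n(b-a) is less than σ; n ≥ 1 is assumed. *)

theory Defs
  imports "HOL-Probability.Probability"
begin

text \<open>
  \<open>\<real>\<close> to the power \<open>n\<close> is the product space \<open>data_space n\<close>, whose points are the extensional
  functions on \<open>{..<n}\<close>. A randomized algorithm is given by the law of its output on each input.
  Measurability in the input (a Markov kernel) is part of the notion, so that the expectation
  over a random input and the internal randomness is a genuine iterated integral.
\<close>

definition data_space :: "nat \<Rightarrow> (nat \<Rightarrow> real) measure" where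
  "data_space n = (\<Pi>\<^sub>M i\<in>{..<n}. borel)"

definition randomized_algorithm :: "nat \<Rightarrow> ((nat \<Rightarrow> real) \<Rightarrow> real measure) \<Rightarrow> bool" where
  "randomized_algorithm n M \<longleftrightarrow> M \<in> data_space n \<rightarrow>\<^sub>M prob_algebra borel"

definition iid_sample :: "nat \<Rightarrow> real measure \<Rightarrow> (nat \<Rightarrow> real) measure" where
  "iid_sample n D = (\<Pi>\<^sub>M i\<in>{..<n}. D)"

text \<open>
  The ratio of densities of \<open>P\<close> and \<open>Q\<close> is the Radon--Nikodym derivative of \<open>P\<close> with respect
  to \<open>Q\<close>, which is positive and finite \<open>P\<close>-almost everywhere. The expectation under \<open>P\<close> is
  taken in \<open>[0, \<infinity>]\<close>; for probability measures it is at least 1, so its logarithm is only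
  delicate at \<open>\<infinity>\<close>.
\<close>

definition renyi_divergence :: "real \<Rightarrow> 'a measure \<Rightarrow> 'a measure \<Rightarrow> ereal" where
  "renyi_divergence \<alpha> P Q =
    (if absolutely_continuous Q P then
       let J = (\<integral>\<^sup>+ x. ennreal (enn2real (RN_deriv Q P x) powr (\<alpha> - 1)) \<partial>P)
       in if J = \<infinity> then \<infinity> else ereal (1 / (\<alpha> - 1) * ln (enn2real J))
     else \<infinity>)"

definition concentrated_dp :: "nat \<Rightarrow> real \<Rightarrow> ((nat \<Rightarrow> real) \<Rightarrow> real measure) \<Rightarrow> bool" where
  "concentrated_dp n \<rho> M \<longleftrightarrow>
    (\<forall>x\<in>space (data_space n). \<forall>y\<in>space (data_space n).
       card {i\<in>{..<n}. x i \<noteq> y i} \<le> 1 \<longrightarrow>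
       (\<forall>\<alpha>>1. renyi_divergence \<alpha> (M x) (M y) \<le> ereal (\<rho> * \<alpha>)))"

text \<open>
  \<open>mean_squared_error n M D \<mu>\<close> is the expectation of the square of \<open>M(X) - \<mu>\<close> over the sample
  \<open>X\<close> and the randomness of \<open>M\<close>, with value \<open>\<infinity>\<close> if that square is not integrable.
\<close>

definition mean_squared_error ::
  "nat \<Rightarrow> ((nat \<Rightarrow> real) \<Rightarrow> real measure) \<Rightarrow> real measure \<Rightarrow> real \<Rightarrow> ennreal" where
  "mean_squared_error n M D \<mu> =
    (\<integral>\<^sup>+ X. (\<integral>\<^sup>+ z. ennreal ((z - \<mu>)\<^sup>2) \<partial>M X) \<partial>iid_sample n D)"

definition has_mean_variance :: "real measure \<Rightarrow> real \<Rightarrow> real \<Rightarrow> bool" where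
  "has_mean_variance D \<mu> v \<longleftrightarrow>
    prob_space D \<and> sets D = sets borel \<and>
    integrable D (\<lambda>x. x) \<and> integrable D (\<lambda>x. x\<^sup>2) \<and>
    prob_space.expectation D (\<lambda>x. x) = \<mu> \<and> prob_space.variance D (\<lambda>x. x) = v"

end

theory Submission
  imports Defs
begin

text \<open>
  The algorithm is a private median of means. Put \<open>L = ln (n * (b - a) / \<sigma>\<^sub>0)\<close>. If \<open>L \<le> 0\<close>, the
  interval \<open>[a, b]\<close> is so short that a constant output is accurate enough. Otherwise split the
  sample into \<open>k\<close> blocks, with \<open>k\<close> about \<open>24 * L / \<epsilon>\<close>, and let \<open>y i\<close> be the mean of block \<open>i\<close>,
  truncated to \<open>[a, b]\<close>. Draw a point of a grid on \<open>[a, b]\<close>, of step at most \<open>\<sigma>\<^sub>0 / n\<close>, by the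
  exponential mechanism: \<open>z\<close> has probability proportional to \<open>exp (- \<epsilon> / 2 * u z)\<close>, where the score
  \<open>u z\<close> (\<open>rank_depth\<close>) measures how far the rank of \<open>z\<close> among the \<open>y i\<close> is from the middle.

  \<^bold>\<open>Privacy.\<close> One entry of the sample affects one block and hence changes every score by at most
  \<open>1\<close>. So the output laws on neighbouring samples have a density ratio in \<open>[exp (-\<epsilon>), exp \<epsilon>]\<close>. By
  Hoeffding's lemma, applied to the logarithm of that ratio, the Renyi divergence of order \<open>\<alpha>\<close> is at
  most \<open>\<epsilon>\<^sup>2 * \<alpha> / 2\<close> (\<open>renyi_divergence_density_le\<close>).

  \<^bold>\<open>Accuracy.\<close> Some grid point has score at most \<open>k / 2\<close> (\<open>exists_grid_median\<close>). The probability that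
  the output has score above \<open>3 * k / 4\<close> is therefore at most the number of grid points times
  \<open>exp (- \<epsilon> * k / 8)\<close>, which is of order \<open>exp (- 2 * L)\<close> by the choice of \<open>k\<close>; as \<open>(b - a)\<^sup>2\<close> equals
  \<open>exp (2 * L) * \<sigma>\<^sub>0\<^sup>2 / n\<^sup>2\<close>, this event costs only \<open>O(\<sigma>\<^sub>0\<^sup>2 / n\<^sup>2)\<close> in mean square. If the score is at
  most \<open>3 * k / 4\<close>, then a quarter of the block means are at least as far from \<open>\<mu>\<close> as the output, up
  to a grid step, so the squared error is at most \<open>8 / k\<close> times the sum of the squared errors of
  the block means, plus a discretisation error (\<open>quartile_sq_dist_le\<close>). Each block mean has
  variance of order \<open>\<sigma>\<^sup>2 * k / n\<close>, and so the total error is of order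
  \<open>\<sigma>\<^sup>2 / n * (1 + L / \<epsilon>)\<close>.
\<close>

section \<open>Bounded density ratios and Renyi divergence\<close>

text \<open>
  A density ratio in \<open>[exp (-c), exp c]\<close> is pure differential privacy with parameter \<open>c\<close>; the
  claim is that it implies concentrated privacy with parameter \<open>c\<^sup>2 / 2\<close>. Let \<open>X = ln r\<close> be the
  privacy loss and \<open>m\<close> its mean under \<open>P\<close>, which is the Kullback--Leibler divergence. As \<open>X\<close>
  ranges in an interval of length \<open>2 * c\<close>, Hoeffding's lemma applies to it in two ways.
  Applied to \<open>-X\<close> it bounds \<open>m\<close>: the expectation of \<open>exp (-X) = 1 / r\<close> under \<open>P\<close> is \<open>1\<close>, whence
  \<open>exp m \<le> exp (c\<^sup>2 / 2)\<close>. Applied to \<open>X\<close> with factor \<open>\<alpha> - 1\<close> it bounds the moment in the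
  divergence by \<open>exp ((\<alpha> - 1) * m + (\<alpha> - 1)\<^sup>2 * c\<^sup>2 / 2)\<close>.
\<close>
lemma renyi_divergence_density_le:
  fixes r :: "'a \<Rightarrow> real"
  assumes "prob_space P" "prob_space Q"
    and P: "P = density Q (\<lambda>x. ennreal (r x))"
    and r [measurable]: "r \<in> borel_measurable Q"
    and bounds: "\<And>x. x \<in> space Q \<Longrightarrow> exp (- c) \<le> r x \<and> r x \<le> exp c"
    and \<alpha>: "\<alpha> > 1"
  shows "renyi_divergence \<alpha> P Q \<le> ereal (1 / 2 * c\<^sup>2 * \<alpha>)"
proof -
  interpret P: prob_space P by fact
  interpret Q: prob_space Q by fact
  have space_P [simp]: "space P = space Q" and sets_P [measurable_cong, simp]: "sets P = sets Q"
    using P by simp_all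
  have r_pos: "r x > 0" if "x \<in> space Q" for x
    using bounds[OF that] exp_gt_zero[of "-c"] by linarith
  define X where "X x = ln (r x)" for x
  have [measurable]: "X \<in> borel_measurable P"
    unfolding X_def by measurable
  have X_bounds: "- c \<le> X x \<and> X x \<le> c" if "x \<in> space Q" for x
    using bounds[OF that] r_pos[OF that] unfolding X_def
    by (metis exp_le_cancel_iff exp_ln)
  interpret X: interval_bounded_random_variable P X "- c" c
    by unfold_locales (auto intro!: AE_I2 dest: X_bounds)
  interpret X': interval_bounded_random_variable P "\<lambda>x. - X x" "- c" c
  proof
    have "- X x \<in> {- c..c}" if "x \<in> space Q" for x
      using X_bounds[OF that] by simp
    thus "AE x in P. - X x \<in> {- c..c}"
      by (intro AE_I2) (simp only: space_P)
  qed measurable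
  define m where "m = P.expectation X"
  have mean_minus: "P.expectation (\<lambda>x. - X x) = - m"
    by (simp add: m_def)
  have four: "(c - - c)\<^sup>2 = 4 * c\<^sup>2"
    by (simp add: power2_eq_square algebra_simps)
  have inverse_ratio: "(\<integral>\<^sup>+ x. ennreal (exp (- X x)) \<partial>P) = 1"
  proof -
    have "(\<integral>\<^sup>+ x. ennreal (exp (- X x)) \<partial>P) = (\<integral>\<^sup>+ x. ennreal (r x) * ennreal (exp (- X x)) \<partial>Q)"
      unfolding P by (rule nn_integral_density) (simp_all add: X_def)
    also have "\<dots> = (\<integral>\<^sup>+ x. 1 \<partial>Q)"
    proof (rule nn_integral_cong)
      fix x assume "x \<in> space Q"
      with r_pos[of x] show "ennreal (r x) * ennreal (exp (- X x)) = 1"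
        by (simp add: X_def exp_minus ennreal_mult'[symmetric])
    qed
    finally show ?thesis by (simp add: Q.emeasure_space_1)
  qed
  have m_le: "m \<le> c\<^sup>2 / 2"
  proof -
    have "ennreal (exp m) = ennreal (exp m) * (\<integral>\<^sup>+ x. ennreal (exp (- X x)) \<partial>P)"
      by (simp add: inverse_ratio)
    also have "\<dots> = (\<integral>\<^sup>+ x. ennreal (exp (1 * (- X x - P.expectation (\<lambda>x. - X x)))) \<partial>P)"
      unfolding mean_minus
      by (subst nn_integral_cmult[symmetric]) (auto simp: ennreal_mult'[symmetric] exp_add[symmetric])
    also have "\<dots> \<le> ennreal (exp (1\<^sup>2 * (c - - c)\<^sup>2 / 8))"
      by (rule X'.Hoeffdings_lemma_nn_integral) simp
    finally show ?thesis by (simp add: four)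
  qed
  define J where "J = (\<integral>\<^sup>+ x. ennreal (enn2real (RN_deriv Q P x) powr (\<alpha> - 1)) \<partial>P)"
  have ac: "absolutely_continuous Q P"
    unfolding P by (intro absolutely_continuousI_density) simp
  have "AE x in Q. ennreal (r x) = RN_deriv Q P x"
    by (rule Q.RN_deriv_unique) (simp_all add: P)
  hence "AE x in P. ennreal (r x) = RN_deriv Q P x"
    by (rule absolutely_continuous_AE[OF _ ac, rotated]) simp
  moreover have "AE x in P. x \<in> space Q"
    by (rule AE_I2) simp
  ultimately have "AE x in P. ennreal (enn2real (RN_deriv Q P x) powr (\<alpha> - 1)) = ennreal (exp ((\<alpha> - 1) * X x))"
  proof eventually_elim
    case (elim x)
    have "enn2real (RN_deriv Q P x) = r x"
      using elim r_pos[of x] by (metis enn2real_ennreal less_imp_le)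
    thus ?case using r_pos[OF elim(2)] by (simp add: powr_def X_def)
  qed
  hence "J = (\<integral>\<^sup>+ x. ennreal (exp ((\<alpha> - 1) * X x)) \<partial>P)"
    unfolding J_def by (rule nn_integral_cong_AE)
  also have "\<dots> = (\<integral>\<^sup>+ x. ennreal (exp ((\<alpha> - 1) * m)) * ennreal (exp ((\<alpha> - 1) * (X x - m))) \<partial>P)"
    by (intro nn_integral_cong) (auto simp: ennreal_mult'[symmetric] exp_add[symmetric] algebra_simps)
  also have "\<dots> = ennreal (exp ((\<alpha> - 1) * m)) * (\<integral>\<^sup>+ x. ennreal (exp ((\<alpha> - 1) * (X x - m))) \<partial>P)"
    by (rule nn_integral_cmult) simp
  also have "\<dots> \<le> ennreal (exp ((\<alpha> - 1) * m)) * ennreal (exp ((\<alpha> - 1)\<^sup>2 * (c - - c)\<^sup>2 / 8))"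
    unfolding m_def by (intro mult_left_mono X.Hoeffdings_lemma_nn_integral) (use \<alpha> in auto)
  also have "\<dots> = ennreal (exp ((\<alpha> - 1) * m + (\<alpha> - 1)\<^sup>2 * c\<^sup>2 / 2))"
    unfolding four by (simp add: ennreal_mult'[symmetric] exp_add[symmetric])
  also have "\<dots> \<le> ennreal (exp ((\<alpha> - 1) * (1 / 2 * c\<^sup>2 * \<alpha>)))"
  proof (intro ennreal_leI, subst exp_le_cancel_iff)
    have "(\<alpha> - 1) * m \<le> (\<alpha> - 1) * (c\<^sup>2 / 2)"
      using m_le \<alpha> by (intro mult_left_mono) auto
    hence "(\<alpha> - 1) * m + (\<alpha> - 1)\<^sup>2 * c\<^sup>2 / 2
        \<le> (\<alpha> - 1) * (c\<^sup>2 / 2) + (\<alpha> - 1)\<^sup>2 * c\<^sup>2 / 2"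
      by simp
    also have "\<dots> = (\<alpha> - 1) * (1 / 2 * c\<^sup>2 * \<alpha>)"
      by (simp add: power2_eq_square field_simps)
    finally show "(\<alpha> - 1) * m + (\<alpha> - 1)\<^sup>2 * c\<^sup>2 / 2 \<le> (\<alpha> - 1) * (1 / 2 * c\<^sup>2 * \<alpha>)" .
  qed
  finally have J_le: "J \<le> ennreal (exp ((\<alpha> - 1) * (1 / 2 * c\<^sup>2 * \<alpha>)))" .
  hence J_fin: "J \<noteq> \<infinity>"
    by (auto simp: top_unique)
  have "ln (enn2real J) \<le> (\<alpha> - 1) * (1 / 2 * c\<^sup>2 * \<alpha>)"
  proof (cases "enn2real J > 0")
    case True
    have "enn2real J \<le> exp ((\<alpha> - 1) * (1 / 2 * c\<^sup>2 * \<alpha>))"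
      using enn2real_mono[OF J_le] by simp
    thus ?thesis using True by (metis exp_gt_zero ln_exp ln_le_cancel_iff)
  next
    case False
    hence "enn2real J = 0" using enn2real_nonneg[of J] by linarith
    thus ?thesis using \<alpha> by simp
  qed
  hence "1 / (\<alpha> - 1) * ln (enn2real J) \<le> 1 / 2 * c\<^sup>2 * \<alpha>"
    using \<alpha> by (simp add: field_simps)
  moreover have "renyi_divergence \<alpha> P Q = ereal (1 / (\<alpha> - 1) * ln (enn2real J))"
    using ac J_fin unfolding renyi_divergence_def J_def[symmetric] by (simp add: Let_def)
  ultimately show ?thesis by simp
qed

section \<open>The exponential mechanism on a finite set of reals\<close>
definition gibbs_weight :: "real set \<Rightarrow> real \<Rightarrow> (real \<Rightarrow> real) \<Rightarrow> real \<Rightarrow> real" where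
  "gibbs_weight G l u z = exp (- (l * u z)) / (\<Sum>w\<in>G. exp (- (l * u w)))"

text \<open>
  The law is written as a density over counting measure on \<open>G\<close>, pushed forward to the Borel sets.
  Since the weight is positive on the whole line, the laws for two scores on the same \<open>G\<close> have an
  everywhere defined density ratio, namely the ratio of the weights.
\<close>
definition exponential_mechanism :: "real set \<Rightarrow> real \<Rightarrow> (real \<Rightarrow> real) \<Rightarrow> real measure" where
  "exponential_mechanism G l u =
     density (distr (count_space G) borel (\<lambda>z. z)) (\<lambda>z. ennreal (gibbs_weight G l u z))"

lemma gibbs_weight_pos:
  assumes "finite G" "G \<noteq> {}"
  shows "gibbs_weight G l u z > 0"
  using assms unfolding gibbs_weight_def by (intro divide_pos_pos sum_pos) auto

lemma sum_gibbs_weight: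
  assumes "finite G" "G \<noteq> {}"
  shows "(\<Sum>z\<in>G. gibbs_weight G l u z) = 1"
proof -
  have "(\<Sum>w\<in>G. exp (- (l * u w))) > 0"
    using assms by (intro sum_pos) auto
  thus ?thesis
    unfolding gibbs_weight_def sum_divide_distrib[symmetric] by simp
qed

lemma borel_measurable_gibbs_weight [measurable (raw)]:
  assumes "u \<in> borel_measurable borel"
  shows "gibbs_weight G l u \<in> borel_measurable borel"
  unfolding gibbs_weight_def using assms by measurable

lemma sets_exponential_mechanism [simp, measurable_cong]:
  "sets (exponential_mechanism G l u) = sets borel"
  by (simp add: exponential_mechanism_def)

lemma space_exponential_mechanism [simp]: "space (exponential_mechanism G l u) = UNIV"
  by (simp add: exponential_mechanism_def)

lemma nn_integral_exponential_mechanism: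
  assumes "finite G" and [measurable]: "u \<in> borel_measurable borel" "F \<in> borel_measurable borel"
  shows "(\<integral>\<^sup>+ z. F z \<partial>exponential_mechanism G l u) =
    (\<Sum>z\<in>G. ennreal (gibbs_weight G l u z) * F z)"
  unfolding exponential_mechanism_def
  by (simp add: nn_integral_density nn_integral_distr nn_integral_count_space_finite assms(1))

lemma prob_space_exponential_mechanism:
  assumes "finite G" "G \<noteq> {}" "u \<in> borel_measurable borel"
  shows "prob_space (exponential_mechanism G l u)"
proof
  have "emeasure (exponential_mechanism G l u) UNIV = (\<integral>\<^sup>+ z. 1 \<partial>exponential_mechanism G l u)"
    by simp
  also have "\<dots> = (\<Sum>z\<in>G. ennreal (gibbs_weight G l u z))"
    using assms by (subst nn_integral_exponential_mechanism) auto
  also have "\<dots> = 1"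
    using assms by (subst sum_ennreal) (auto intro: less_imp_le gibbs_weight_pos simp: sum_gibbs_weight)
  finally show "emeasure (exponential_mechanism G l u) (space (exponential_mechanism G l u)) = 1"
    by simp
qed

lemma measurable_exponential_mechanism:
  assumes "finite G" "G \<noteq> {}"
    and "\<And>x. x \<in> space N \<Longrightarrow> u x \<in> borel_measurable borel"
    and u [measurable]: "\<And>z. z \<in> G \<Longrightarrow> (\<lambda>x. u x z) \<in> borel_measurable N"
  shows "(\<lambda>x. exponential_mechanism G l (u x)) \<in> N \<rightarrow>\<^sub>M prob_algebra borel"
proof (intro measurable_prob_algebraI measurable_subprob_algebra)
  show "prob_space (exponential_mechanism G l (u x))" if "x \<in> space N" for x
    using assms that by (intro prob_space_exponential_mechanism) auto
  then show "subprob_space (exponential_mechanism G l (u x))" if "x \<in> space N" for x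
    using that by (intro prob_space_imp_subprob_space)
  show "sets (exponential_mechanism G l (u x)) = sets borel" for x
    by simp
  fix A :: "real set" assume A [measurable]: "A \<in> sets borel"
  have "(\<lambda>x. \<Sum>z\<in>G. ennreal (gibbs_weight G l (u x) z) * indicator A z) \<in> borel_measurable N"
    unfolding gibbs_weight_def
    by (intro borel_measurable_sum borel_measurable_times_ennreal borel_measurable_const
        measurable_compose[OF _ measurable_ennreal] borel_measurable_divide) measurable
  also have "?this \<longleftrightarrow> (\<lambda>x. emeasure (exponential_mechanism G l (u x)) A) \<in> borel_measurable N"
  proof (rule measurable_cong)
    fix x assume "x \<in> space N"
    then have [measurable]: "u x \<in> borel_measurable borel" by (rule assms)
    have "emeasure (exponential_mechanism G l (u x)) A =
        (\<integral>\<^sup>+ z. indicator A z \<partial>exponential_mechanism G l (u x))"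
      by simp
    thus "(\<Sum>z\<in>G. ennreal (gibbs_weight G l (u x) z) * indicator A z) =
        emeasure (exponential_mechanism G l (u x)) A"
      by (simp add: nn_integral_exponential_mechanism assms(1) del: nn_integral_indicator)
  qed
  finally show "(\<lambda>x. emeasure (exponential_mechanism G l (u x)) A) \<in> borel_measurable N" .
qed

text \<open>
  One factor \<open>exp l\<close> comes from the numerator and one from the normalising sum.
\<close>
lemma gibbs_weight_ratio_le:
  assumes "finite G" "G \<noteq> {}" "l \<ge> 0" "\<And>z. \<bar>u z - v z\<bar> \<le> 1"
  shows "gibbs_weight G l u z \<le> exp (2 * l) * gibbs_weight G l v z"
proof -
  define U V where "U = (\<Sum>w\<in>G. exp (- (l * u w)))" and "V = (\<Sum>w\<in>G. exp (- (l * v w)))"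
  have pos: "U > 0" "V > 0"
    unfolding U_def V_def using assms(1,2) by (auto intro!: sum_pos)
  have shift: "- (l * x) \<le> l + - (l * y)" if "\<bar>x - y\<bar> \<le> 1" for x y :: real
  proof -
    have "l * (y - x) \<le> l * 1"
      using assms(3) that by (intro mult_left_mono) auto
    thus ?thesis by (simp add: algebra_simps)
  qed
  have num: "exp (- (l * u z)) \<le> exp l * exp (- (l * v z))"
    unfolding exp_add[symmetric] exp_le_cancel_iff by (rule shift) (rule assms)
  have "V \<le> exp l * U"
    unfolding U_def V_def sum_distrib_left exp_add[symmetric]
    by (intro sum_mono, subst exp_le_cancel_iff, rule shift) (metis assms(4) abs_minus_commute)
  hence "exp (- (l * u z)) * V \<le> (exp l * exp (- (l * v z))) * (exp l * U)"
    using num pos by (intro mult_mono) auto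
  hence "exp (- (l * u z)) / U \<le> (exp l * exp l * exp (- (l * v z))) / V"
    using pos by (simp add: field_simps)
  also have "exp l * exp l = exp (2 * l)"
    by (simp add: exp_add[symmetric])
  finally show ?thesis
    unfolding gibbs_weight_def U_def V_def by simp
qed

lemma renyi_divergence_exponential_mechanism_le:
  assumes "finite G" "G \<noteq> {}" "l \<ge> 0" "\<And>z. \<bar>u z - v z\<bar> \<le> 1" "\<alpha> > 1"
    and [measurable]: "u \<in> borel_measurable borel" "v \<in> borel_measurable borel"
  shows "renyi_divergence \<alpha> (exponential_mechanism G l u) (exponential_mechanism G l v)
    \<le> ereal (1 / 2 * (2 * l)\<^sup>2 * \<alpha>)"
proof (rule renyi_divergence_density_le)
  let ?r = "\<lambda>z. gibbs_weight G l u z / gibbs_weight G l v z"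
  note pos = gibbs_weight_pos[OF assms(1,2)]
  show "exponential_mechanism G l u = density (exponential_mechanism G l v) (\<lambda>z. ennreal (?r z))"
  proof -
    have "ennreal (gibbs_weight G l v z) * ennreal (?r z) = ennreal (gibbs_weight G l u z)" for z
      using pos[of l v z] pos[of l u z] by (simp add: ennreal_mult'[symmetric])
    thus ?thesis
      unfolding exponential_mechanism_def by (subst density_density_eq) auto
  qed
  show "exp (- (2 * l)) \<le> ?r z \<and> ?r z \<le> exp (2 * l)" for z
  proof -
    have "gibbs_weight G l u z \<le> exp (2 * l) * gibbs_weight G l v z"
      using assms by (intro gibbs_weight_ratio_le)
    moreover have "gibbs_weight G l v z \<le> exp (2 * l) * gibbs_weight G l u z"
      using assms by (intro gibbs_weight_ratio_le) (auto simp: abs_minus_commute)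
    ultimately show ?thesis
      using pos[of l v z] pos[of l u z] by (simp add: exp_minus field_simps)
  qed
qed (use assms in \<open>auto intro: prob_space_exponential_mechanism\<close>)

text \<open>
  The utility guarantee in the form of an expected loss. A point whose score exceeds \<open>t\<close> has
  weight at most \<open>exp (- (l * (t - s)))\<close>, because the normalising sum already contains the term
  of \<open>z\<^sub>0\<close>. Such points contribute at most \<open>R\<close> each; all others together contribute at most \<open>B\<close>.
\<close>
lemma exponential_mechanism_expectation_le:
  assumes "finite G" "z\<^sub>0 \<in> G" "u z\<^sub>0 \<le> s" "l \<ge> 0" "B \<ge> 0" "R \<ge> 0"
    and [measurable]: "u \<in> borel_measurable borel" "F \<in> borel_measurable borel"
    and nonneg: "\<And>z. F z \<ge> 0"
    and good: "\<And>z. z \<in> G \<Longrightarrow> u z \<le> t \<Longrightarrow> F z \<le> B"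
    and bad: "\<And>z. z \<in> G \<Longrightarrow> F z \<le> R"
  shows "(\<integral>\<^sup>+ z. ennreal (F z) \<partial>exponential_mechanism G l u)
    \<le> ennreal (B + real (card G) * exp (- (l * (t - s))) * R)"
proof -
  let ?w = "gibbs_weight G l u"
  have ne: "G \<noteq> {}" using assms by auto
  have w0: "0 \<le> ?w z" for z
    using gibbs_weight_pos[OF assms(1) ne] less_imp_le by blast
  have unlikely: "?w z \<le> exp (- (l * (t - s)))" if "z \<in> G" "u z > t" for z
  proof -
    have "exp (- (l * u z\<^sub>0)) \<le> (\<Sum>w\<in>G. exp (- (l * u w)))"
      using assms(1,2) by (intro member_le_sum) auto
    hence "?w z \<le> exp (- (l * u z)) / exp (- (l * u z\<^sub>0))"
      unfolding gibbs_weight_def by (intro divide_left_mono mult_pos_pos) (auto intro!: sum_pos assms(1) simp: ne)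
    also have "\<dots> = exp (- (l * (u z - u z\<^sub>0)))"
      by (simp add: exp_diff[symmetric] algebra_simps)
    also have "\<dots> \<le> exp (- (l * (t - s)))"
      using that assms by (simp add: mult_left_mono)
    finally show ?thesis .
  qed
  have summand: "?w z * F z \<le> ?w z * B + exp (- (l * (t - s))) * R" if "z \<in> G" for z
  proof (cases "u z \<le> t")
    case True
    hence "?w z * F z \<le> ?w z * B"
      using w0 good that by (intro mult_left_mono) auto
    thus ?thesis using assms(6) by (simp add: add_increasing2)
  next
    case False
    hence "?w z * F z \<le> exp (- (l * (t - s))) * R"
      using w0 unlikely that bad nonneg by (intro mult_mono) auto
    thus ?thesis using w0[of z] assms(5) by (simp add: add_increasing)
  qed
  have "(\<integral>\<^sup>+ z. ennreal (F z) \<partial>exponential_mechanism G l u) = ennreal (\<Sum>z\<in>G. ?w z * F z)"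
    using assms w0 nonneg
    by (subst nn_integral_exponential_mechanism) (auto simp: ennreal_mult'[symmetric])
  also have "\<dots> \<le> ennreal (\<Sum>z\<in>G. ?w z * B + exp (- (l * (t - s))) * R)"
    by (intro ennreal_leI sum_mono summand)
  also have "(\<Sum>z\<in>G. ?w z * B + exp (- (l * (t - s))) * R) = B + real (card G) * exp (- (l * (t - s))) * R"
    by (simp add: sum.distrib sum_distrib_right[symmetric] sum_gibbs_weight[OF assms(1) ne])
  finally show ?thesis .
qed


section \<open>Approximate medians on a grid\<close>
definition grid :: "real \<Rightarrow> real \<Rightarrow> nat \<Rightarrow> real set" where
  "grid a h K = (\<lambda>j. a + real j * h) ` {..K}"

text \<open>
  This score is smallest near the middle of \<open>y 0, \<dots>, y (k - 1)\<close>. The count on the left is taken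
  one grid step further away: a left count of \<open>y i < z\<close> could jump past \<open>k / 2\<close> between two
  neighbouring grid points, leaving no grid point of small score.
\<close>
definition rank_depth :: "real \<Rightarrow> nat \<Rightarrow> (nat \<Rightarrow> real) \<Rightarrow> real \<Rightarrow> real" where
  "rank_depth h k y z = max (real (card {i\<in>{..<k}. y i \<le> z - h})) (real (card {i\<in>{..<k}. z < y i}))"

text \<open>
  The witness is the first grid point that has at least half of the values at or below it: then
  at most half lie above, and by minimality at most half lie at or below its predecessor.
\<close>
lemma exists_grid_median:
  assumes "h > 0" "k \<ge> 1" and y: "\<And>i. i < k \<Longrightarrow> y i \<in> {a..a + real K * h}"
  shows "\<exists>z\<in>grid a h K. rank_depth h k y z \<le> real k / 2"
proof -
  define L where "L j = {i\<in>{..<k}. y i \<le> a + real j * h}" for j :: nat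
  have split: "card {i\<in>{..<k}. a + real j * h < y i} + card (L j) = k" for j
  proof -
    have "card {i\<in>{..<k}. a + real j * h < y i} + card (L j) =
        card ({i\<in>{..<k}. a + real j * h < y i} \<union> L j)"
      by (subst card_Un_disjoint) (auto simp: L_def)
    also have "{i\<in>{..<k}. a + real j * h < y i} \<union> L j = {..<k}"
      by (auto simp: L_def)
    finally show ?thesis by simp
  qed
  have "L K = {..<k}"
    using y by (auto simp: L_def)
  hence ex: "2 * card (L K) \<ge> k" by simp
  define j where "j = (LEAST j. 2 * card (L j) \<ge> k)"
  have j: "2 * card (L j) \<ge> k" "j \<le> K"
    unfolding j_def using ex by (rule LeastI, intro Least_le)
  have "2 * card {i\<in>{..<k}. y i \<le> (a + real j * h) - h} \<le> k"
  proof (cases j)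
    case 0
    hence "{i\<in>{..<k}. y i \<le> (a + real j * h) - h} = {}"
      using y assms(1) by fastforce
    thus ?thesis by (simp only: card.empty)
  next
    case (Suc i)
    have "\<not> 2 * card (L i) \<ge> k"
      using Suc not_less_Least[of i "\<lambda>j. 2 * card (L j) \<ge> k"] unfolding j_def by simp
    moreover have "{i\<in>{..<k}. y i \<le> (a + real j * h) - h} = L i"
      unfolding L_def Suc by (simp add: algebra_simps)
    ultimately show ?thesis by simp
  qed
  moreover have "2 * card {i\<in>{..<k}. a + real j * h < y i} \<le> k"
    using split[of j] j(1) by linarith
  ultimately have "rank_depth h k y (a + real j * h) \<le> real k / 2"
    unfolding rank_depth_def by linarith
  thus ?thesis using j(2) unfolding grid_def by auto
qed

text \<open>
  If \<open>z\<close> is not too deep on either side, then at least a quarter of the values lie on the far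
  side of \<open>z\<close> (up to one grid step) as seen from \<open>\<mu>\<close>, and each of them is at least as far from
  \<open>\<mu>\<close> as \<open>z\<close>. So the squared error of an approximate median is controlled by the average squared
  error of the values, for every \<open>\<mu>\<close> and for every number \<open>k\<close> of values. The bound is
  deterministic, so in expectation only second moments of the values enter.
\<close>
lemma quartile_sq_dist_le:
  assumes "h \<ge> 0" "k \<ge> 1" and depth: "rank_depth h k y z \<le> 3 * real k / 4"
  shows "(z - \<mu>)\<^sup>2 \<le> 2 * h\<^sup>2 + 8 / real k * (\<Sum>i<k. (y i - \<mu>)\<^sup>2)"
proof -
  have many: "real k / 4 \<le> real (card (A::nat set))"
    if "real (card B) \<le> 3 * real k / 4" "A \<union> B = {..<k}" for A B
  proof -
    have "real k \<le> real (card A) + real (card B)"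
      using card_Un_le[of A B] that(2) by (metis card_lessThan of_nat_add of_nat_le_iff)
    thus ?thesis using that(1) by linarith
  qed
  have markov: "real k / 4 * d\<^sup>2 \<le> (\<Sum>i<k. (y i - \<mu>)\<^sup>2)"
    if "real k / 4 \<le> real (card A)" "A \<subseteq> {..<k}" "\<And>i. i \<in> A \<Longrightarrow> d\<^sup>2 \<le> (y i - \<mu>)\<^sup>2" for A and d :: real
  proof -
    have "real k / 4 * d\<^sup>2 \<le> real (card A) * d\<^sup>2"
      by (intro mult_right_mono that) auto
    also have "\<dots> = (\<Sum>i\<in>A. d\<^sup>2)" by simp
    also have "\<dots> \<le> (\<Sum>i\<in>A. (y i - \<mu>)\<^sup>2)" by (intro sum_mono that)
    also have "\<dots> \<le> (\<Sum>i<k. (y i - \<mu>)\<^sup>2)" by (intro sum_mono2 that) auto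
    finally show ?thesis .
  qed
  let ?S = "\<Sum>i<k. (y i - \<mu>)\<^sup>2"
  have S0: "?S \<ge> 0" by (intro sum_nonneg) auto
  have k0: "real k > 0" using assms(2) by simp
  consider "z \<le> \<mu>" | "\<mu> < z" "z \<le> \<mu> + h" | "z > \<mu> + h" by linarith
  thus ?thesis
  proof cases
    case 1
    have "real k / 4 * (z - \<mu>)\<^sup>2 \<le> ?S"
    proof (rule markov)
      show "real k / 4 \<le> real (card {i\<in>{..<k}. y i \<le> z})"
        by (rule many[of "{i\<in>{..<k}. z < y i}"]) (use depth in \<open>auto simp: rank_depth_def\<close>)
      show "(z - \<mu>)\<^sup>2 \<le> (y i - \<mu>)\<^sup>2" if "i \<in> {i\<in>{..<k}. y i \<le> z}" for i
        using 1 that by (simp add: abs_le_square_iff[symmetric])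
    qed auto
    hence "(z - \<mu>)\<^sup>2 \<le> 4 / real k * ?S"
      using k0 by (simp add: field_simps)
    also have "\<dots> \<le> 8 / real k * ?S"
      using S0 k0 by (intro mult_right_mono divide_right_mono) auto
    finally show ?thesis by (simp add: add_increasing)
  next
    case 2
    hence "(z - \<mu>)\<^sup>2 \<le> h\<^sup>2" by (intro power_mono) auto
    moreover have "8 / real k * ?S \<ge> 0" using S0 by simp
    ultimately show ?thesis using zero_le_power2[of h] by linarith
  next
    case 3
    have "real k / 4 * (z - h - \<mu>)\<^sup>2 \<le> ?S"
    proof (rule markov)
      show "real k / 4 \<le> real (card {i\<in>{..<k}. z - h < y i})"
        by (rule many[of "{i\<in>{..<k}. y i \<le> z - h}"]) (use depth in \<open>auto simp: rank_depth_def\<close>)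
      show "(z - h - \<mu>)\<^sup>2 \<le> (y i - \<mu>)\<^sup>2" if "i \<in> {i\<in>{..<k}. z - h < y i}" for i
        using 3 that by (intro power_mono) auto
    qed auto
    hence "(z - h - \<mu>)\<^sup>2 \<le> 4 / real k * ?S"
      using k0 by (simp add: field_simps)
    moreover have "(z - \<mu>)\<^sup>2 \<le> 2 * h\<^sup>2 + 2 * (z - h - \<mu>)\<^sup>2"
      using zero_le_power2[of "z - \<mu> - 2 * h"] by (simp add: power2_eq_square algebra_simps)
    ultimately show ?thesis by simp
  qed
qed

lemma rank_depth_change_one:
  assumes "\<And>i. i < k \<Longrightarrow> i \<noteq> g \<Longrightarrow> y i = y' i"
  shows "\<bar>rank_depth h k y z - rank_depth h k y' z\<bar> \<le> 1"
proof -
  have count: "card {i\<in>{..<k}. P (u i)} \<le> Suc (card {i\<in>{..<k}. P (v i)})"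
    if "\<And>i. i < k \<Longrightarrow> i \<noteq> g \<Longrightarrow> u i = v i" for P and u v :: "nat \<Rightarrow> real"
  proof -
    have "card {i\<in>{..<k}. P (u i)} \<le> card (insert g {i\<in>{..<k}. P (v i)})"
      using that by (intro card_mono) auto
    also have "\<dots> \<le> Suc (card {i\<in>{..<k}. P (v i)})"
      by (rule card_insert_le_m1) auto
    finally show ?thesis .
  qed
  have count': "real (card {i\<in>{..<k}. P (y i)}) \<le> 1 + real (card {i\<in>{..<k}. P (y' i)}) \<and>
      real (card {i\<in>{..<k}. P (y' i)}) \<le> 1 + real (card {i\<in>{..<k}. P (y i)})" for P
    using count[of y y' P] count[of y' y P] assms by force
  show ?thesis
    unfolding rank_depth_def
    using count'[of "\<lambda>t. t \<le> z - h"] count'[of "\<lambda>t. z < t"] by linarith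
qed

lemma borel_measurable_rank_depth [measurable (raw)]:
  assumes [measurable]: "\<And>i. i < k \<Longrightarrow> (\<lambda>x. y x i) \<in> borel_measurable N" "f \<in> borel_measurable N"
  shows "(\<lambda>x. rank_depth h k (y x) (f x)) \<in> borel_measurable N"
proof -
  have count: "real (card {i\<in>{..<k}. P i}) = (\<Sum>i<k. if P i then 1 else 0)" for P
    by (simp add: sum.If_cases Int_def)
  have [measurable]: "(\<lambda>x. (\<Sum>i<k. if y x i \<le> f x - h then 1 else 0 :: real)) \<in> borel_measurable N"
    by (intro borel_measurable_sum measurable_If borel_measurable_const borel_measurable_le) auto
  have [measurable]: "(\<lambda>x. (\<Sum>i<k. if f x < y x i then 1 else 0 :: real)) \<in> borel_measurable N"
    by (intro borel_measurable_sum measurable_If borel_measurable_const borel_measurable_less) auto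
  show ?thesis
    unfolding rank_depth_def count by measurable
qed

section \<open>Means of disjoint blocks\<close>
definition block_mean :: "nat \<Rightarrow> (nat \<Rightarrow> real) \<Rightarrow> nat \<Rightarrow> real" where
  "block_mean m x i = (\<Sum>t\<in>{i * m..<i * m + m}. x t) / real m"

lemma block_mean_cong_off:
  assumes "\<And>j. j \<noteq> t \<Longrightarrow> j < k * m \<Longrightarrow> x j = x' j" "i \<noteq> t div m" "i < k"
  shows "block_mean m x i = block_mean m x' i"
proof -
  have "x j = x' j" if j: "j \<in> {i * m..<i * m + m}" for j
  proof (rule assms(1))
    have "j div m = i"
      using j by (intro div_nat_eqI) (auto simp: algebra_simps)
    thus "j \<noteq> t" using assms(2) by auto
    have "Suc i * m \<le> k * m" using assms(3) by (intro mult_right_mono) auto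
    thus "j < k * m" using j by simp
  qed
  hence "sum x {i * m..<i * m + m} = sum x' {i * m..<i * m + m}"
    by (intro sum.cong) auto
  thus ?thesis unfolding block_mean_def by simp
qed

text \<open>
  The variance of a mean of independent observations. Expanding the square leaves covariances of
  two coordinates. To compute one, the product of two coordinates is written as a product over
  all coordinates in which the others contribute the factor \<open>1\<close>, so that the integral factorises.
\<close>
lemma nn_integral_mean_sq_dist:
  assumes D: "has_mean_variance D \<mu> v" and J: "J \<subseteq> {..<n}" "J \<noteq> {}"
  shows "(\<integral>\<^sup>+ x. ennreal (((\<Sum>j\<in>J. x j) / real (card J) - \<mu>)\<^sup>2) \<partial>iid_sample n D)
    = ennreal (v / real (card J))"
proof -
  have fin: "finite J" using J(1) finite_subset by blast
  interpret D: prob_space D using D by (simp add: has_mean_variance_def)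
  have [measurable_cong]: "sets D = sets borel"
    and [simp]: "integrable D (\<lambda>x. x)" "integrable D (\<lambda>x. x\<^sup>2)" "D.expectation (\<lambda>x. x) = \<mu>"
    and var: "D.variance (\<lambda>x. x) = v"
    using D unfolding has_mean_variance_def by auto
  interpret P: product_sigma_finite "\<lambda>_::nat. D" ..
  have centred: "integrable D (\<lambda>x. x - \<mu>)" "D.expectation (\<lambda>x. x - \<mu>) = 0"
    by (simp_all add: D.prob_space)
  have "integrable D (\<lambda>x. x\<^sup>2 - 2 * \<mu> * x + \<mu>\<^sup>2)"
    by (intro Bochner_Integration.integrable_add Bochner_Integration.integrable_diff) auto
  hence sq: "integrable D (\<lambda>x. (x - \<mu>)\<^sup>2)" "D.expectation (\<lambda>x. (x - \<mu>)\<^sup>2) = v"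
    using var by (simp_all add: power2_diff algebra_simps)
  have pair: "integrable (iid_sample n D) (\<lambda>x. (x i - \<mu>) * (x j - \<mu>)) \<and>
      (\<integral>x. (x i - \<mu>) * (x j - \<mu>) \<partial>iid_sample n D) = (if i = j then v else 0)"
    if "i \<in> J" "j \<in> J" for i j
  proof -
    define f where "f = (\<lambda>l t. (if l = i then t - \<mu> else 1) * (if l = j then t - \<mu> else 1))"
    have int: "integrable D (f l)" for l
      using centred(1) sq(1) by (cases "l = i"; cases "l = j") (simp_all add: f_def power2_eq_square)
    have mean: "D.expectation (f l) =
        (if l = i \<and> l = j then v else if l = i \<or> l = j then 0 else 1)" for l
      using centred(2) sq(2) by (cases "l = i"; cases "l = j")
        (simp_all add: f_def power2_eq_square D.prob_space)
    have in_n: "i \<in> {..<n}" "j \<in> {..<n}" using that J by auto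
    have prod: "(\<Prod>l<n. f l (x l)) = (x i - \<mu>) * (x j - \<mu>)" for x
      using in_n by (simp add: f_def prod.distrib prod.delta)
    have "(\<Prod>l<n. D.expectation (f l)) = (if i = j then v else 0)"
    proof (cases "i = j")
      case True
      hence "(\<Prod>l<n. D.expectation (f l)) = (\<Prod>l<n. if l = i then v else 1)"
        by (intro prod.cong) (auto simp: mean)
      thus ?thesis using in_n True by (simp add: prod.delta)
    next
      case False
      thus ?thesis using in_n by (auto intro!: prod_zero bexI[of _ i] simp: mean)
    qed
    moreover have "integrable (iid_sample n D) (\<lambda>x. \<Prod>l<n. f l (x l))"
      unfolding iid_sample_def by (intro P.product_integrable_prod int) auto
    moreover have "(\<integral>x. (\<Prod>l<n. f l (x l)) \<partial>iid_sample n D) = (\<Prod>l<n. D.expectation (f l))"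
      unfolding iid_sample_def by (intro P.product_integral_prod int) auto
    ultimately show ?thesis by (simp add: prod)
  qed
  define c where "c = real (card J)"
  have c: "c > 0" using J(2) fin by (auto simp: c_def card_gt_0_iff)
  have expand: "((\<Sum>j\<in>J. x j) / c - \<mu>)\<^sup>2 = (\<Sum>i\<in>J. \<Sum>j\<in>J. (x i - \<mu>) * (x j - \<mu>)) / c\<^sup>2" for x
  proof -
    have "(\<Sum>j\<in>J. x j) / c - \<mu> = (\<Sum>j\<in>J. x j - \<mu>) / c"
      using c by (simp add: sum_subtractf c_def field_simps)
    thus ?thesis by (simp add: power2_eq_square sum_product)
  qed
  have nonneg: "0 \<le> (\<Sum>i\<in>J. \<Sum>j\<in>J. (x i - \<mu>) * (x j - \<mu>)) / c\<^sup>2" for x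
    by (metis expand zero_le_power2)
  have int: "integrable (iid_sample n D) (\<lambda>x. (\<Sum>i\<in>J. \<Sum>j\<in>J. (x i - \<mu>) * (x j - \<mu>)) / c\<^sup>2)"
    using pair by (intro integrable_divide Bochner_Integration.integrable_sum) blast
  have "(\<integral>x. (\<Sum>i\<in>J. \<Sum>j\<in>J. (x i - \<mu>) * (x j - \<mu>)) / c\<^sup>2 \<partial>iid_sample n D)
      = (\<Sum>i\<in>J. \<Sum>j\<in>J. if i = j then v else 0) / c\<^sup>2"
    using pair by (simp add: Bochner_Integration.integral_sum)
  also have "\<dots> = v / c"
    using c fin by (simp add: c_def power2_eq_square)
  finally show ?thesis
    unfolding c_def[symmetric]
    by (subst nn_integral_eq_integral) (simp_all add: expand int nonneg)
qed

section \<open>The private median of means\<close>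

text \<open>
  Block means are truncated to \<open>[a, b]\<close> so that their median lies in the range of the grid. As
  \<open>\<mu>\<close> is in \<open>[a, b]\<close>, truncation brings no block mean further away from it.
\<close>
definition private_median_of_means ::
  "real \<Rightarrow> real \<Rightarrow> nat \<Rightarrow> nat \<Rightarrow> nat \<Rightarrow> real \<Rightarrow> (nat \<Rightarrow> real) \<Rightarrow> real measure" where
  "private_median_of_means a b K m k l x =
     (let h = (b - a) / real K in
      exponential_mechanism (grid a h K) l
        (rank_depth h k (\<lambda>i. max a (min b (block_mean m x i)))))"

lemma finite_grid [simp]: "finite (grid a h K)"
  and grid_nonempty [simp]: "grid a h K \<noteq> {}"
  and card_grid_le: "card (grid a h K) \<le> K + 1"
  unfolding grid_def using card_image_le[of "{..K}" "\<lambda>j. a + real j * h"] by auto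

lemma borel_measurable_block_mean:
  assumes "k * m \<le> n" "i < k"
  shows "(\<lambda>x. block_mean m x i) \<in> borel_measurable (data_space n)"
  unfolding block_mean_def data_space_def
proof (intro borel_measurable_divide borel_measurable_sum borel_measurable_const)
  fix t assume t: "t \<in> {i * m..<i * m + m}"
  have "Suc i * m \<le> k * m" using assms(2) by (intro mult_right_mono) auto
  hence "t \<in> {..<n}" using t assms(1) by auto
  thus "(\<lambda>x. x t) \<in> borel_measurable (\<Pi>\<^sub>M i\<in>{..<n}. borel)" by measurable
qed

lemma randomized_algorithm_private_median_of_means:
  assumes "k * m \<le> n"
  shows "randomized_algorithm n (private_median_of_means a b K m k l)"
  unfolding randomized_algorithm_def private_median_of_means_def Let_def
proof (rule measurable_exponential_mechanism)
  fix z :: real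
  have [measurable]: "(\<lambda>x. block_mean m x i) \<in> borel_measurable (data_space n)" if "i < k" for i
    by (rule borel_measurable_block_mean[OF assms that])
  show "(\<lambda>x. rank_depth ((b - a) / real K) k (\<lambda>i. max a (min b (block_mean m x i))) z)
      \<in> borel_measurable (data_space n)"
    by measurable
qed auto

text \<open>
  Blocks are disjoint, so changing entry \<open>t\<close> changes only the block with index \<open>t div m\<close>, and
  changing one block mean changes a count of block means by at most one.
\<close>
lemma concentrated_dp_private_median_of_means:
  assumes "k * m \<le> n" "l \<ge> 0"
  shows "concentrated_dp n (1 / 2 * (2 * l)\<^sup>2) (private_median_of_means a b K m k l)"
  unfolding concentrated_dp_def
proof (intro ballI impI allI)
  fix x x' :: "nat \<Rightarrow> real" and \<alpha> :: real
  assume "card {i\<in>{..<n}. x i \<noteq> x' i} \<le> 1" and \<alpha>: "1 < \<alpha>"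
  then obtain t where "{i\<in>{..<n}. x i \<noteq> x' i} \<subseteq> {t}"
    by (auto simp: card_le_Suc0_iff_eq) blast
  hence off: "x j = x' j" if "j \<noteq> t" "j < k * m" for j
  proof -
    have "j < n" using that(2) assms(1) by linarith
    thus ?thesis using \<open>_ \<subseteq> {t}\<close> that(1) by blast
  qed
  show "renyi_divergence \<alpha> (private_median_of_means a b K m k l x) (private_median_of_means a b K m k l x')
      \<le> ereal (1 / 2 * (2 * l)\<^sup>2 * \<alpha>)"
    unfolding private_median_of_means_def Let_def
  proof (rule renyi_divergence_exponential_mechanism_le)
    show "\<bar>rank_depth ((b - a) / real K) k (\<lambda>i. max a (min b (block_mean m x i))) z
        - rank_depth ((b - a) / real K) k (\<lambda>i. max a (min b (block_mean m x' i))) z\<bar> \<le> 1" for z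
      by (rule rank_depth_change_one[of _ "t div m"]) (use block_mean_cong_off[OF off] in auto)
  qed (use assms \<alpha> in auto)
qed

text \<open>
  The error for a fixed data set. An output whose score is at most \<open>3 * k / 4\<close> obeys the
  deterministic bound for approximate medians, and any other output is at most \<open>b - a\<close> away from
  \<open>\<mu>\<close>. The best grid point has score at most \<open>k / 2\<close>, so the gap in score is \<open>k / 4\<close>.
\<close>
lemma private_median_of_means_sq_error_le:
  assumes "a < b" "\<mu> \<in> {a..b}" "K \<ge> 1" "k \<ge> 1" "l \<ge> 0"
  shows "(\<integral>\<^sup>+ z. ennreal ((z - \<mu>)\<^sup>2) \<partial>private_median_of_means a b K m k l x)
    \<le> ennreal (2 * ((b - a) / real K)\<^sup>2 + 8 / real k * (\<Sum>i<k. (block_mean m x i - \<mu>)\<^sup>2)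
        + real (K + 1) * exp (- (l * real k / 4)) * (b - a)\<^sup>2)"
proof -
  define h where "h = (b - a) / real K"
  define y where "y i = max a (min b (block_mean m x i))" for i
  have h: "h > 0" "a + real K * h = b"
    using assms by (simp_all add: h_def)
  obtain z\<^sub>0 where z0: "z\<^sub>0 \<in> grid a h K" "rank_depth h k y z\<^sub>0 \<le> real k / 2"
    using exists_grid_median[of h k y a K] h assms by (auto simp: y_def)
  have clamp: "(y i - \<mu>)\<^sup>2 \<le> (block_mean m x i - \<mu>)\<^sup>2" for i
    using assms(2) unfolding abs_le_square_iff[symmetric] y_def by (auto simp: max_def min_def)
  have sums: "(\<Sum>i<k. (y i - \<mu>)\<^sup>2) \<le> (\<Sum>i<k. (block_mean m x i - \<mu>)\<^sup>2)"
    by (intro sum_mono clamp)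
  let ?B = "2 * h\<^sup>2 + 8 / real k * (\<Sum>i<k. (block_mean m x i - \<mu>)\<^sup>2)"
  have "(\<integral>\<^sup>+ z. ennreal ((z - \<mu>)\<^sup>2) \<partial>exponential_mechanism (grid a h K) l (rank_depth h k y))
    \<le> ennreal (?B + real (card (grid a h K)) * exp (- (l * (3 * real k / 4 - real k / 2))) * (b - a)\<^sup>2)"
  proof (rule exponential_mechanism_expectation_le[where z\<^sub>0 = z\<^sub>0])
    show "?B \<ge> 0" by (intro add_nonneg_nonneg mult_nonneg_nonneg sum_nonneg) auto
    show "(z - \<mu>)\<^sup>2 \<le> ?B" if "rank_depth h k y z \<le> 3 * real k / 4" for z
    proof -
      have "(z - \<mu>)\<^sup>2 \<le> 2 * h\<^sup>2 + 8 / real k * (\<Sum>i<k. (y i - \<mu>)\<^sup>2)"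
        using quartile_sq_dist_le[OF _ assms(4) that] h by simp
      also have "\<dots> \<le> ?B"
        using sums by (intro add_left_mono mult_left_mono) auto
      finally show ?thesis .
    qed
    show "(z - \<mu>)\<^sup>2 \<le> (b - a)\<^sup>2" if z: "z \<in> grid a h K" for z
    proof -
      obtain j where j: "j \<le> K" "z = a + real j * h"
        using z by (auto simp: grid_def)
      have "real j * h \<le> real K * h" using j h by (intro mult_right_mono) auto
      moreover have "real j * h \<ge> 0" using h by simp
      ultimately have "z \<in> {a..b}" using j h by auto
      thus ?thesis using assms(2) unfolding abs_le_square_iff[symmetric] by auto
    qed
  qed (use z0 assms in auto)
  also have "\<dots> \<le> ennreal (?B + real (K + 1) * exp (- (l * real k / 4)) * (b - a)\<^sup>2)"
    using card_grid_le[of a h K] by (intro ennreal_leI add_left_mono mult_mono) auto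
  finally show ?thesis
    unfolding private_median_of_means_def Let_def h_def y_def .
qed

lemma mean_squared_error_private_median_of_means_le:
  assumes D: "has_mean_variance D \<mu> v" and "v \<ge> 0" "a < b" "\<mu> \<in> {a..b}" "K \<ge> 1" "k \<ge> 1" "l \<ge> 0"
    and m: "m \<ge> 1" "k * m \<le> n"
  shows "mean_squared_error n (private_median_of_means a b K m k l) D \<mu>
    \<le> ennreal (2 * ((b - a) / real K)\<^sup>2 + 8 * v / real m
        + real (K + 1) * exp (- (l * real k / 4)) * (b - a)\<^sup>2)"
proof -
  define E where "E = 2 * ((b - a) / real K)\<^sup>2 + real (K + 1) * exp (- (l * real k / 4)) * (b - a)\<^sup>2"
  have E: "E \<ge> 0" by (simp add: E_def)
  have D_prob: "prob_space D" and D_sets: "sets D = sets borel"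
    using D by (simp_all add: has_mean_variance_def)
  interpret iid: prob_space "iid_sample n D"
    unfolding iid_sample_def by (rule prob_space_PiM) (rule D_prob)
  have sets_iid: "sets (iid_sample n D) = sets (data_space n)"
    unfolding iid_sample_def data_space_def by (intro sets_PiM_cong) (auto simp: D_sets)
  have [measurable]: "(\<lambda>x. block_mean m x i) \<in> borel_measurable (iid_sample n D)" if "i < k" for i
    by (subst measurable_cong_sets[OF sets_iid refl]) (rule borel_measurable_block_mean[OF m(2) that])
  have block: "(\<integral>\<^sup>+ x. ennreal ((block_mean m x i - \<mu>)\<^sup>2) \<partial>iid_sample n D) = ennreal (v / real m)"
    if "i < k" for i
  proof -
    have "Suc i * m \<le> k * m" using that by (intro mult_right_mono) auto
    hence "{i * m..<i * m + m} \<subseteq> {..<n}" using m(2) by auto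
    thus ?thesis
      using nn_integral_mean_sq_dist[OF D, of "{i * m..<i * m + m}"] m(1) by (simp add: block_mean_def)
  qed
  have "mean_squared_error n (private_median_of_means a b K m k l) D \<mu>
      \<le> (\<integral>\<^sup>+ x. ennreal E + (\<Sum>i<k. ennreal (8 / real k) * ennreal ((block_mean m x i - \<mu>)\<^sup>2))
          \<partial>iid_sample n D)"
    unfolding mean_squared_error_def
  proof (rule nn_integral_mono)
    fix x
    have "(\<integral>\<^sup>+ z. ennreal ((z - \<mu>)\<^sup>2) \<partial>private_median_of_means a b K m k l x)
        \<le> ennreal (E + (\<Sum>i<k. 8 / real k * (block_mean m x i - \<mu>)\<^sup>2))"
      using private_median_of_means_sq_error_le[of a b \<mu> K k l m x] assms
      by (simp add: E_def sum_distrib_left algebra_simps)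
    also have "\<dots> = ennreal E + (\<Sum>i<k. ennreal (8 / real k) * ennreal ((block_mean m x i - \<mu>)\<^sup>2))"
      using E by (subst ennreal_plus) (auto intro!: sum_nonneg simp: ennreal_mult'[symmetric])
    finally show "(\<integral>\<^sup>+ z. ennreal ((z - \<mu>)\<^sup>2) \<partial>private_median_of_means a b K m k l x) \<le> \<dots>" .
  qed
  also have "\<dots> = ennreal E + (\<Sum>i<k. ennreal (8 / real k) * ennreal (v / real m))"
  proof -
    have "(\<integral>\<^sup>+ x. ennreal E + (\<Sum>i<k. ennreal (8 / real k) * ennreal ((block_mean m x i - \<mu>)\<^sup>2))
        \<partial>iid_sample n D) = (\<integral>\<^sup>+ x. ennreal E \<partial>iid_sample n D)
        + (\<Sum>i<k. \<integral>\<^sup>+ x. ennreal (8 / real k) * ennreal ((block_mean m x i - \<mu>)\<^sup>2) \<partial>iid_sample n D)"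
      by (subst nn_integral_add; (subst nn_integral_sum)?)
        (auto intro!: borel_measurable_sum)
    thus ?thesis
      by (simp add: nn_integral_cmult block iid.emeasure_space_1)
  qed
  also have "\<dots> = ennreal (E + 8 * v / real m)"
    using E assms by (simp add: ennreal_mult'[symmetric] ennreal_plus[symmetric] del: sum_constant ennreal_plus)
      (simp add: ennreal_plus[symmetric] del: ennreal_plus)
  finally show ?thesis by (simp add: E_def algebra_simps)
qed

section \<open>Choice of the parameters\<close>

theorem theorem7:
  shows "\<exists>C\<^sub>1>0. \<exists>C\<^sub>2>0. \<forall>(\<epsilon>::real) (\<sigma>\<^sub>0::real) (a::real) (b::real) (n::nat).
    \<epsilon> > 0 \<longrightarrow> \<sigma>\<^sub>0 > 0 \<longrightarrow> a < b \<longrightarrow> n \<ge> 1 \<longrightarrow>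
    real n \<ge> C\<^sub>1 * (ln (real n * (b - a) / \<sigma>\<^sub>0) / \<epsilon>) \<longrightarrow>
    (\<exists>M. randomized_algorithm n M \<and> concentrated_dp n (1/2 * \<epsilon>\<^sup>2) M \<and>
      (\<forall>D \<mu> \<sigma>. has_mean_variance D \<mu> (\<sigma>\<^sup>2) \<and> \<mu> \<in> {a..b} \<and> \<sigma>\<^sup>2 \<ge> \<sigma>\<^sub>0\<^sup>2 \<longrightarrow>
        mean_squared_error n M D \<mu> \<le>
          ennreal (\<sigma>\<^sup>2 / real n *
            (C\<^sub>2 * max 1 (ln (real n * (b - a) / \<sigma>\<^sub>0) / \<epsilon> + 1 / \<epsilon>\<^sup>2)))))"
proof (rule exI[of _ "24::real"], rule conjI, simp, rule exI[of _ "405::real"], rule conjI, simp,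
    intro allI impI)
  fix \<epsilon> \<sigma>\<^sub>0 a b :: real and n :: nat
  assume eps: "\<epsilon> > 0" and s0: "\<sigma>\<^sub>0 > 0" and ab: "a < b" and n: "n \<ge> 1"
    and large: "real n \<ge> 24 * (ln (real n * (b - a) / \<sigma>\<^sub>0) / \<epsilon>)"
  (* exp L counts the steps of length \<sigma>\<^sub>0 / n that fit into the interval from a to b. *)
  define L where "L = ln (real n * (b - a) / \<sigma>\<^sub>0)"
  define T where "T = max 1 (L / \<epsilon> + 1 / \<epsilon>\<^sup>2)"
  have T: "T \<ge> 1" "L / \<epsilon> \<le> T"
    unfolding T_def by (auto simp: le_max_iff_disj intro: disjI2)
  have exp_L: "exp L = real n * (b - a) / \<sigma>\<^sub>0"
    unfolding L_def using n ab s0 by (intro exp_ln divide_pos_pos mult_pos_pos) auto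
  hence ba: "b - a = exp L * \<sigma>\<^sub>0 / real n"
    using n s0 by (simp add: field_simps)
  have s0_le: "\<sigma>\<^sub>0\<^sup>2 / (real n)\<^sup>2 \<le> v / real n" if "\<sigma>\<^sub>0\<^sup>2 \<le> v" for v
  proof -
    have "\<sigma>\<^sub>0\<^sup>2 / (real n)\<^sup>2 \<le> \<sigma>\<^sub>0\<^sup>2 / real n"
      using n by (intro divide_left_mono) (auto simp: power2_eq_square)
    also have "\<dots> \<le> v / real n"
      using that by (intro divide_right_mono) auto
    finally show ?thesis .
  qed
  have "\<exists>M. randomized_algorithm n M \<and> concentrated_dp n (1/2 * \<epsilon>\<^sup>2) M \<and>
      (\<forall>D \<mu> v. has_mean_variance D \<mu> v \<and> \<mu> \<in> {a..b} \<and> v \<ge> \<sigma>\<^sub>0\<^sup>2 \<longrightarrow>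
        mean_squared_error n M D \<mu> \<le> ennreal (v / real n * (405 * T)))"
  (* For L \<le> 0 the interval has length at most \<sigma>\<^sub>0 / n, and any fixed point of it is accurate. *)
  proof (cases "L \<le> 0")
    case True
    show ?thesis
    proof (intro exI[of _ "\<lambda>_. return borel a"] conjI allI impI)
      show "randomized_algorithm n (\<lambda>_. return borel a)"
        unfolding randomized_algorithm_def
        by (intro measurable_const) (simp add: space_prob_algebra prob_space_return)
      show "concentrated_dp n (1/2 * \<epsilon>\<^sup>2) (\<lambda>_. return borel a)"
        unfolding concentrated_dp_def
      proof (intro ballI allI impI)
        fix \<alpha> :: real assume "\<alpha> > 1"
        thus "renyi_divergence \<alpha> (return borel a) (return borel a) \<le> ereal (1 / 2 * \<epsilon>\<^sup>2 * \<alpha>)"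
          by (intro renyi_divergence_density_le[where r = "\<lambda>_. 1"])
            (use eps in \<open>auto simp: prob_space_return density_1\<close>)
      qed
      fix D \<mu> v assume asm: "has_mean_variance D \<mu> v \<and> \<mu> \<in> {a..b} \<and> v \<ge> \<sigma>\<^sub>0\<^sup>2"
      interpret iid: prob_space "iid_sample n D"
        unfolding iid_sample_def by (rule prob_space_PiM) (use asm in \<open>simp add: has_mean_variance_def\<close>)
      have "(a - \<mu>)\<^sup>2 \<le> (b - a)\<^sup>2"
        using asm unfolding abs_le_square_iff[symmetric] by auto
      also have "(b - a)\<^sup>2 \<le> (\<sigma>\<^sub>0 / real n)\<^sup>2"
        unfolding ba using ab True s0 by (intro power_mono divide_right_mono) auto
      also have "\<dots> \<le> v / real n"
        using s0_le[of v] asm by (simp add: power_divide)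
      also have "\<dots> = v / real n * 1" by simp
      also have "\<dots> \<le> v / real n * (405 * T)"
        using T asm order_trans[OF zero_le_power2[of \<sigma>\<^sub>0], of v] by (intro mult_left_mono) auto
      finally have "(a - \<mu>)\<^sup>2 \<le> v / real n * (405 * T)" .
      thus "mean_squared_error n (\<lambda>_. return borel a) D \<mu> \<le> ennreal (v / real n * (405 * T))"
        unfolding mean_squared_error_def
        by (simp add: nn_integral_return iid.emeasure_space_1 ennreal_leI)
    qed
  next
    case False
    hence L: "L > 0" by simp
    (* The factor 24 makes the failure probability of order exp (- 2 * L): with score scale
       \<epsilon> / 2 and score gap k / 4, a bad grid point has weight at most exp (- (\<epsilon> * k / 8)), which
       is then at most exp (- 3 * L), and there are about exp L grid points. *)
    define k where "k = nat \<lceil>24 * (L / \<epsilon>)\<rceil>"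
    define m where "m = n div k"
    define K where "K = nat \<lceil>exp L\<rceil>"
    have k_pos: "24 * (L / \<epsilon>) > 0" using L eps by simp
    have k: "k \<ge> 1" "real k \<ge> 24 * (L / \<epsilon>)" "real k \<le> 24 * (L / \<epsilon>) + 1" "k \<le> n"
    proof -
      show "k \<ge> 1" "real k \<ge> 24 * (L / \<epsilon>)" "real k \<le> 24 * (L / \<epsilon>) + 1"
        unfolding k_def using k_pos by linarith+
      have "\<lceil>24 * (L / \<epsilon>)\<rceil> \<le> int n"
        using large unfolding L_def by (intro ceiling_le) simp
      thus "k \<le> n" unfolding k_def by (simp only: nat_le_iff)
    qed
    have K: "K \<ge> 1" "real K \<ge> exp L" "real K \<le> exp L + 1"
      unfolding K_def using exp_gt_zero[of L] by linarith+
    have km: "k * m \<le> n" unfolding m_def by simp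
    have m: "m \<ge> 1" unfolding m_def using k by (simp add: div_greater_zero_iff Suc_le_eq)
    (* Rounding the block length down loses at most a factor 2. *)
    have "n < (m + 1) * k"
      unfolding m_def using k(1) dividend_less_div_times[of k n] by simp
    also have "\<dots> \<le> (2 * m) * k" using m by (intro mult_right_mono) auto
    finally have "real n \<le> real (2 * m * k)" by linarith
    hence inv_m: "1 / real m \<le> 2 * real k / real n"
      using m n by (simp add: field_simps)
    let ?M = "private_median_of_means a b K m k (\<epsilon> / 2)"
    have tail: "real (K + 1) * exp (- (\<epsilon> / 2 * real k / 4)) * (b - a)\<^sup>2 \<le> 3 * (\<sigma>\<^sub>0\<^sup>2 / (real n)\<^sup>2)"
    proof -
      have "3 * L \<le> \<epsilon> / 2 * real k / 4"
        using k(2) eps by (simp add: field_simps)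
      moreover have "real (K + 1) \<le> 3 * exp L"
      proof -
        have "1 \<le> exp L" using L by simp
        thus ?thesis using K(3) by linarith
      qed
      ultimately have "real (K + 1) * exp (- (\<epsilon> / 2 * real k / 4)) * (b - a)\<^sup>2
          \<le> (3 * exp L) * exp (- (3 * L)) * (b - a)\<^sup>2"
        by (intro mult_right_mono mult_mono) auto
      also have "\<dots> = 3 * (exp L * exp (- (3 * L)) * exp L * exp L) * (\<sigma>\<^sub>0\<^sup>2 / (real n)\<^sup>2)"
        unfolding ba by (simp add: power2_eq_square)
      also have "exp L * exp (- (3 * L)) * exp L * exp L = 1"
        by (simp add: exp_add[symmetric])
      finally show ?thesis by simp
    qed
    have step: "2 * ((b - a) / real K)\<^sup>2 \<le> 2 * (\<sigma>\<^sub>0\<^sup>2 / (real n)\<^sup>2)"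
    proof -
      have "(b - a) / real K \<le> (b - a) / exp L"
        using K ab by (intro divide_left_mono) auto
      also have "\<dots> = \<sigma>\<^sub>0 / real n" unfolding ba by simp
      finally have "((b - a) / real K)\<^sup>2 \<le> (\<sigma>\<^sub>0 / real n)\<^sup>2"
        using ab by (intro power_mono) auto
      thus ?thesis by (simp add: power_divide)
    qed
    show ?thesis
    proof (intro exI[of _ ?M] conjI allI impI)
      show "randomized_algorithm n ?M"
        by (rule randomized_algorithm_private_median_of_means[OF km])
      show "concentrated_dp n (1 / 2 * \<epsilon>\<^sup>2) ?M"
        using concentrated_dp_private_median_of_means[OF km, of "\<epsilon> / 2" a b K] eps by simp
      fix D \<mu> v assume asm: "has_mean_variance D \<mu> v \<and> \<mu> \<in> {a..b} \<and> v \<ge> \<sigma>\<^sub>0\<^sup>2"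
      hence v: "v \<ge> 0" using order_trans[OF zero_le_power2[of \<sigma>\<^sub>0], of v] by simp
      (* 8 * 2 * 25 = 400 from the block means, 2 from the grid step, 3 from the failure event. *)
      have "8 * v / real m = 8 * v * (1 / real m)" by simp
      also have "\<dots> \<le> 8 * v * (2 * real k / real n)"
        using v inv_m by (intro mult_left_mono) auto
      also have "\<dots> \<le> 8 * v * (2 * (25 * T) / real n)"
        using v k(3) T by (intro mult_left_mono divide_right_mono) auto
      also have "\<dots> = v / real n * (400 * T)" by (simp add: field_simps)
      finally have blocks: "8 * v / real m \<le> v / real n * (400 * T)" .
      have rest: "5 * (v / real n) \<le> v / real n * (5 * T)"
        using mult_left_mono[OF T(1), of "5 * (v / real n)"] v by (simp add: mult_ac)
      have total: "v / real n * (405 * T) = v / real n * (400 * T) + v / real n * (5 * T)"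
        by (simp add: algebra_simps)
      have add: "A + B + C \<le> Z"
        if "A \<le> 2 * q" "B \<le> X" "C \<le> 3 * q" "q \<le> w" "5 * w \<le> Y" "Z = X + Y"
        for A B C X Y Z q w :: real
        using that by linarith
      have "2 * ((b - a) / real K)\<^sup>2 + 8 * v / real m
          + real (K + 1) * exp (- (\<epsilon> / 2 * real k / 4)) * (b - a)\<^sup>2 \<le> v / real n * (405 * T)"
        by (rule add[OF step blocks tail s0_le rest total]) (use asm in blast)
      hence "ennreal (2 * ((b - a) / real K)\<^sup>2 + 8 * v / real m
          + real (K + 1) * exp (- (\<epsilon> / 2 * real k / 4)) * (b - a)\<^sup>2) \<le> ennreal (v / real n * (405 * T))"
        by (rule ennreal_leI)
      moreover have "mean_squared_error n ?M D \<mu> \<le> ennreal (2 * ((b - a) / real K)\<^sup>2 + 8 * v / real m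
          + real (K + 1) * exp (- (\<epsilon> / 2 * real k / 4)) * (b - a)\<^sup>2)"
        by (rule mean_squared_error_private_median_of_means_le) (use asm v ab K k eps m km in auto)
      ultimately show "mean_squared_error n ?M D \<mu> \<le> ennreal (v / real n * (405 * T))"
        by (rule order_trans[rotated])
    qed
  qed
  thus "\<exists>M. randomized_algorithm n M \<and> concentrated_dp n (1/2 * \<epsilon>\<^sup>2) M \<and>
      (\<forall>D \<mu> \<sigma>. has_mean_variance D \<mu> (\<sigma>\<^sup>2) \<and> \<mu> \<in> {a..b} \<and> \<sigma>\<^sup>2 \<ge> \<sigma>\<^sub>0\<^sup>2 \<longrightarrow>
        mean_squared_error n M D \<mu> \<le>
          ennreal (\<sigma>\<^sup>2 / real n *
            (405 * max 1 (ln (real n * (b - a) / \<sigma>\<^sub>0) / \<epsilon> + 1 / \<epsilon>\<^sup>2))))"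
    unfolding T_def L_def by blast
qed

end
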